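(* Every unimodular amenable locally compact second countable (lcsc) group is sofic.
   Context: lcsc means locally compact, second countable (and Hausdorff). Let $G$ be an lcsc group. $G$ is unimodular if its left-Haar measure is also right-invariant. $G$ is amenable if for every left-Haar measure $\mathrm{Haar}_G$ there exists a sequence $\{F_i\}_{i=1}^\infty$ of Borel subsets of $G$ with finite positive measure such that for every nonempty compact $K\subset G$, $\lim_{i\to\infty}\mathrm{Haar}_G(KF_i)/\mathrm{Haar}_G(F_i)=1$. Local $G$-spaces. A partial right-action of $G$ on a Hausdorff space $M$ is a continuous map $\alpha:\mathrm{dom}(\alpha)\to M$, with $\mathrm{dom}(\alpha)\subset M\times G$ open, such that for all $p\in M$ and $g,h\in G$: (1) $(p,1_G)\in \mathrm{dom}(\alpha)$ and $\alpha(p,1_G)=p$; (2) if $(p,g)\in\mathrm{dom}(\alpha)$ then $(\alpha(p,g),g^{-1})\in\mathrm{dom}(\alpha)$ and $\alpha(\alpha(p,g),g^{-1})=p$; (3) if $(p,g),(\alpha(p,g),h),(p,gh)\in\mathrm{dom}(\alpha)$ then $\alpha(p,gh)=\alpha(\alpha(p,g),h)$. It is homogeneous if moreover (4) for every $p\in M$ there is an open neighborhood $O_p$ of $1_G$ in $G$ such that $\{p\}\times O_p\subset\mathrm{dom}(\alpha)$ and $g\mapsto\alpha(p,g)$ restricted to $O_p$ is a homeomorphism onto an open neighborhood of $p$ in $M$. A local $G$-space is a pair $(M,\alpha)$ with $M$ an lcsc space and $\alpha$ a partial homogeneous right-action of $G$ on $M$. Write $p.g=\alpha(p,g)$ (well-defined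 when $(p,g)\in\mathrm{dom}(\alpha)$) and $p.g.h=(p.g).h$. Charts and the canonical measure. A chart centered at $p\in M$ is a homeomorphism $f_p:\mathrm{dom}(f_p)\to\mathrm{rng}(f_p)$ from an open neighborhood of $p$ in $M$ onto an open neighborhood of $1_G$ in $G$ with $f_p(p.g)=g$ for all $g\in\mathrm{rng}(f_p)$. Fix a left-Haar measure $\mathrm{Haar}_G$ on $G$. $\mathrm{vol}_M$ denotes the unique Radon measure on $M$ such that $\mathrm{vol}_M(K)=\mathrm{Haar}_G(f_p(K))$ whenever $f_p$ is a chart and $K\subset\mathrm{dom}(f_p)$ is Borel. Soficity. For $U\subset G$ open and pre-compact, $M[U]$ is the set of all $p\in M$ such that (i) whenever $g,h\in G$ satisfy $g,h,gh\in U$, then $p.g.h=p.gh$ (in particular both sides are well-defined), and (ii) $g\mapsto p.g$ is a homeomorphism from $U$ to an open neighborhood of $p$. For $\epsilon>0$, $M$ is a $(U,\epsilon)$-sofic approximation to $G$ if $\mathrm{vol}_M(M)<\infty$ and $\mathrm{vol}_M(M[U])\ge(1-\epsilon)\mathrm{vol}_M(M)$. A sofic approximation to $G$ is a sequence $(M_i)_{i=1}^\infty$ where $M_i$ is a $(U_i,\epsilon_i)$-sofic approximation, the $U_i$ are pre-compact open sets increasing to $G$, $\epsilon_i$ decreases to $0$, and $M_i$ is nonempty for all but finitely many $i$. $G$ is sofic if it admits a sofic approximation. *)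

theory Defs
  imports "HOL-Analysis.Analysis"
begin

text \<open>
  The ambient group \<open>G\<close> is a type of class \<open>topological_group_add\<close>.  This class does not assume
  commutativity: \<open>g + h\<close>, \<open>0\<close>, \<open>- g\<close> stand for \<open>gh\<close>, \<open>1\<^sub>G\<close>, \<open>g\<^sup>-\<^sup>1\<close> in a possibly
  nonabelian group.
\<close>

section \<open>Radon and Haar measures\<close>

definition borel_of :: "'a topology \<Rightarrow> 'a measure"
  where "borel_of X = sigma (topspace X) {U. openin X U}"

lemma borel_of_euclidean: "borel_of euclidean = (borel :: 'a::topological_space measure)"
  by (simp add: borel_of_def borel_def)

definition radon_measure :: "'a topology \<Rightarrow> 'a measure \<Rightarrow> bool"
  where "radon_measure X \<mu> \<longleftrightarrow>
    sets \<mu> = sets (borel_of X) \<and>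
    (\<forall>K. compactin X K \<longrightarrow> emeasure \<mu> K < \<infinity>) \<and>
    (\<forall>A \<in> sets \<mu>. emeasure \<mu> A = (INF V \<in> {V. openin X V \<and> A \<subseteq> V}. emeasure \<mu> V)) \<and>
    (\<forall>V. openin X V \<longrightarrow> emeasure \<mu> V = (SUP K \<in> {K. compactin X K \<and> K \<subseteq> V}. emeasure \<mu> K))"

definition left_invariant :: "'g::topological_group_add measure \<Rightarrow> bool"
  where "left_invariant \<mu> \<longleftrightarrow>
    (\<forall>g. \<forall>A \<in> sets borel. emeasure \<mu> ((\<lambda>x. g + x) ` A) = emeasure \<mu> A)"

definition right_invariant :: "'g::topological_group_add measure \<Rightarrow> bool"
  where "right_invariant \<mu> \<longleftrightarrow>
    (\<forall>g. \<forall>A \<in> sets borel. emeasure \<mu> ((\<lambda>x. x + g) ` A) = emeasure \<mu> A)"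

definition left_haar_measure :: "'g::topological_group_add measure \<Rightarrow> bool"
  where "left_haar_measure \<mu> \<longleftrightarrow>
    radon_measure euclidean \<mu> \<and> emeasure \<mu> UNIV \<noteq> 0 \<and> left_invariant \<mu>"

definition unimodular :: "'g::topological_group_add itself \<Rightarrow> bool"
  where "unimodular _ \<longleftrightarrow> (\<forall>\<mu> :: 'g measure. left_haar_measure \<mu> \<longrightarrow> right_invariant \<mu>)"

text \<open>
  For \<open>K\<close> compact and \<open>F\<close> Borel the product set \<open>KF\<close> is analytic, hence measurable for the
  completion of Haar measure but not necessarily Borel.  On such sets the outer measure is the
  completed Haar measure, whereas \<open>emeasure\<close> would return \<open>0\<close> when \<open>KF\<close> is not Borel.
\<close>

definition amenable :: "'g::topological_group_add itself \<Rightarrow> bool"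
  where "amenable _ \<longleftrightarrow>
    (\<forall>\<mu> :: 'g measure. left_haar_measure \<mu> \<longrightarrow>
      (\<exists>F :: nat \<Rightarrow> 'g set.
        (\<forall>i. F i \<in> sets borel \<and> 0 < emeasure \<mu> (F i) \<and> emeasure \<mu> (F i) < \<infinity>) \<and>
        (\<forall>K. compact K \<and> K \<noteq> {} \<longrightarrow>
          (\<lambda>i. outer_measure_of \<mu> {k + f | k f. k \<in> K \<and> f \<in> F i} / emeasure \<mu> (F i))
            \<longlonglongrightarrow> 1)))"

section \<open>Local G-spaces\<close>

text \<open>
  A partial right action on the space \<open>M\<close> is given by its domain \<open>D\<close> and a function \<open>\<alpha>\<close>, with
  \<open>\<alpha> p g\<close> meaning \<open>p.g\<close>; the values of \<open>\<alpha>\<close> outside \<open>D\<close> are irrelevant.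
\<close>

definition partial_right_action ::
    "'m topology \<Rightarrow> ('m \<times> 'g::topological_group_add) set \<Rightarrow> ('m \<Rightarrow> 'g \<Rightarrow> 'm) \<Rightarrow> bool"
  where "partial_right_action M D \<alpha> \<longleftrightarrow>
    Hausdorff_space M \<and>
    openin (prod_topology M euclidean) D \<and>
    continuous_map (subtopology (prod_topology M euclidean) D) M (\<lambda>(p, g). \<alpha> p g) \<and>
    (\<forall>p \<in> topspace M. (p, 0) \<in> D \<and> \<alpha> p 0 = p) \<and>
    (\<forall>p g. (p, g) \<in> D \<longrightarrow> (\<alpha> p g, - g) \<in> D \<and> \<alpha> (\<alpha> p g) (- g) = p) \<and>
    (\<forall>p g h. (p, g) \<in> D \<and> (\<alpha> p g, h) \<in> D \<and> (p, g + h) \<in> D \<longrightarrow>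
      \<alpha> p (g + h) = \<alpha> (\<alpha> p g) h)"

definition orbit_map_homeo ::
    "'m topology \<Rightarrow> ('m \<times> 'g::topological_group_add) set \<Rightarrow> ('m \<Rightarrow> 'g \<Rightarrow> 'm) \<Rightarrow> 'm \<Rightarrow> 'g set \<Rightarrow> bool"
  where "orbit_map_homeo M D \<alpha> p U \<longleftrightarrow>
    {p} \<times> U \<subseteq> D \<and>
    (\<exists>V. openin M V \<and> p \<in> V \<and> homeomorphic_map (top_of_set U) (subtopology M V) (\<alpha> p))"

definition homogeneous_action ::
    "'m topology \<Rightarrow> ('m \<times> 'g::topological_group_add) set \<Rightarrow> ('m \<Rightarrow> 'g \<Rightarrow> 'm) \<Rightarrow> bool"
  where "homogeneous_action M D \<alpha> \<longleftrightarrow>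
    (\<forall>p \<in> topspace M. \<exists>O\<^sub>p. open O\<^sub>p \<and> 0 \<in> O\<^sub>p \<and> orbit_map_homeo M D \<alpha> p O\<^sub>p)"

definition local_G_space ::
    "'m topology \<Rightarrow> ('m \<times> 'g::topological_group_add) set \<Rightarrow> ('m \<Rightarrow> 'g \<Rightarrow> 'm) \<Rightarrow> bool"
  where "local_G_space M D \<alpha> \<longleftrightarrow>
    locally_compact_space M \<and> second_countable M \<and> Hausdorff_space M \<and>
    partial_right_action M D \<alpha> \<and> homogeneous_action M D \<alpha>"

section \<open>Charts and the canonical measure\<close>

definition chart ::
    "'m topology \<Rightarrow> ('m \<times> 'g::topological_group_add) set \<Rightarrow> ('m \<Rightarrow> 'g \<Rightarrow> 'm) \<Rightarrow>
      'm \<Rightarrow> 'm set \<Rightarrow> 'g set \<Rightarrow> ('m \<Rightarrow> 'g) \<Rightarrow> bool"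
  where "chart M D \<alpha> p W R f \<longleftrightarrow>
    openin M W \<and> p \<in> W \<and> open R \<and> 0 \<in> R \<and>
    homeomorphic_map (subtopology M W) (top_of_set R) f \<and>
    (\<forall>g \<in> R. (p, g) \<in> D \<and> \<alpha> p g \<in> W \<and> f (\<alpha> p g) = g)"

definition vol ::
    "'g::topological_group_add measure \<Rightarrow>
      'm topology \<Rightarrow> ('m \<times> 'g) set \<Rightarrow> ('m \<Rightarrow> 'g \<Rightarrow> 'm) \<Rightarrow> 'm measure"
  where "vol Haar M D \<alpha> = (THE \<nu>. radon_measure M \<nu> \<and>
    (\<forall>p W R f K. chart M D \<alpha> p W R f \<and> K \<in> sets (borel_of M) \<and> K \<subseteq> W \<longrightarrow>
      emeasure \<nu> K = emeasure Haar (f ` K)))"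

section \<open>Soficity\<close>

text \<open>
  \<open>good_points M D \<alpha> U\<close> is the set \<open>M[U]\<close>; the requirement that both sides of
  \<open>p.g.h = p.gh\<close> be well-defined is spelled out through membership in \<open>D\<close>.
\<close>

definition good_points ::
    "'m topology \<Rightarrow> ('m \<times> 'g::topological_group_add) set \<Rightarrow> ('m \<Rightarrow> 'g \<Rightarrow> 'm) \<Rightarrow> 'g set \<Rightarrow> 'm set"
  where "good_points M D \<alpha> U = {p \<in> topspace M.
    (\<forall>g h. g \<in> U \<and> h \<in> U \<and> g + h \<in> U \<longrightarrow>
      (p, g) \<in> D \<and> (\<alpha> p g, h) \<in> D \<and> (p, g + h) \<in> D \<and> \<alpha> (\<alpha> p g) h = \<alpha> p (g + h)) \<and>
    orbit_map_homeo M D \<alpha> p U}"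

definition sofic_approx_at ::
    "'g::topological_group_add measure \<Rightarrow> 'g set \<Rightarrow> real \<Rightarrow>
      'm topology \<Rightarrow> ('m \<times> 'g) set \<Rightarrow> ('m \<Rightarrow> 'g \<Rightarrow> 'm) \<Rightarrow> bool"
  where "sofic_approx_at Haar U \<epsilon> M D \<alpha> \<longleftrightarrow>
    emeasure (vol Haar M D \<alpha>) (topspace M) < \<infinity> \<and>
    measure (vol Haar M D \<alpha>) (good_points M D \<alpha> U)
      \<ge> (1 - \<epsilon>) * measure (vol Haar M D \<alpha>) (topspace M)"

definition sofic_approximation ::
    "'g::topological_group_add measure \<Rightarrow>
      (nat \<Rightarrow> 'm topology) \<Rightarrow> (nat \<Rightarrow> ('m \<times> 'g) set) \<Rightarrow> (nat \<Rightarrow> 'm \<Rightarrow> 'g \<Rightarrow> 'm) \<Rightarrow> bool"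
  where "sofic_approximation Haar M D \<alpha> \<longleftrightarrow>
    (\<forall>i. local_G_space (M i) (D i) (\<alpha> i)) \<and>
    (\<exists>(U :: nat \<Rightarrow> 'g set) (\<epsilon> :: nat \<Rightarrow> real).
      (\<forall>i. open (U i) \<and> compact (closure (U i))) \<and> incseq U \<and> (\<Union>i. U i) = UNIV \<and>
      (\<forall>i. 0 < \<epsilon> i) \<and> decseq \<epsilon> \<and> \<epsilon> \<longlonglongrightarrow> 0 \<and>
      (\<forall>i. sofic_approx_at Haar (U i) (\<epsilon> i) (M i) (D i) (\<alpha> i))) \<and>
    (\<forall>\<^sub>F i in sequentially. topspace (M i) \<noteq> {})"

text \<open>
  A quantifier over all local \<open>G\<close>-spaces needs one type containing their points.  A second
  countable Hausdorff space has at most continuum many points, so it is homeomorphic to one whose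
  points are of type \<open>nat set\<close>; using this type loses no generality.
\<close>

lemma second_countable_Hausdorff_nat_set_copy:
  fixes X :: "'a topology"
  assumes "second_countable X" and "Hausdorff_space X"
  shows "\<exists>Y :: nat set topology. X homeomorphic_space Y"
proof -
  obtain \<B> where "countable \<B>" and "\<forall>V \<in> \<B>. openin X V"
      and \<B>_base: "\<forall>U x. openin X U \<and> x \<in> U \<longrightarrow> (\<exists>V \<in> \<B>. x \<in> V \<and> V \<subseteq> U)"
    using assms(1) unfolding second_countable_def by (elim exE conjE)
  define f where "f p = to_nat_on \<B> ` {V \<in> \<B>. p \<in> V}" for p
  have inj: "inj_on f (topspace X)"
  proof (rule inj_onI, rule ccontr)
    fix x y assume xy: "x \<in> topspace X" "y \<in> topspace X" "f x = f y" "x \<noteq> y"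
    have "\<exists>U W. openin X U \<and> openin X W \<and> x \<in> U \<and> y \<in> W \<and> disjnt U W"
      using assms(2) xy(1,2,4) unfolding Hausdorff_space_def by simp
    then obtain U W where "openin X U" "x \<in> U" "y \<in> W" "disjnt U W"
      by (elim exE conjE)
    have "\<exists>V \<in> \<B>. x \<in> V \<and> V \<subseteq> U"
      using \<B>_base \<open>openin X U\<close> \<open>x \<in> U\<close> by simp
    then obtain V where V: "V \<in> \<B>" "x \<in> V" "V \<subseteq> U" by (elim bexE conjE)
    have "to_nat_on \<B> V \<in> f x" using V(1,2) unfolding f_def by simp
    then have "to_nat_on \<B> V \<in> f y" by (simp only: xy(3))
    then obtain V' where V': "V' \<in> \<B>" "y \<in> V'" "to_nat_on \<B> V = to_nat_on \<B> V'"
      unfolding f_def by blast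
    have "V = V'" by (rule inj_onD[OF inj_on_to_nat_on[OF \<open>countable \<B>\<close>] V'(3) V(1) V'(1)])
    then show False using V V'(2) \<open>disjnt U W\<close> \<open>y \<in> W\<close> unfolding disjnt_iff by blast
  qed
  define S where "S = f ` topspace X"
  define g where "g = inv_into (topspace X) f"
  have gX: "g y \<in> topspace X" and fg: "f (g y) = y" if "y \<in> S" for y
    using that unfolding S_def g_def by (fact inv_into_into, fact f_inv_into_f)
  have gf: "g (f x) = x" and fS: "f x \<in> S" if "x \<in> topspace X" for x
    unfolding S_def g_def using that by (fact inv_into_f_f[OF inj], fact imageI)
  have top: "topspace (pullback_topology S g X) = S"
    unfolding topspace_pullback_topology using gX by blast
  have "homeomorphic_maps X (pullback_topology S g X) f g"
    unfolding homeomorphic_maps_def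
  proof (intro conjI ballI)
    show "continuous_map (pullback_topology S g X) X g"
      unfolding continuous_map_def top
    proof (intro conjI allI impI)
      show "g \<in> S \<rightarrow> topspace X" using gX by blast
      fix U assume "openin X U"
      moreover have "{y \<in> S. g y \<in> U} = g -` U \<inter> S" by blast
      ultimately show "openin (pullback_topology S g X) {y \<in> S. g y \<in> U}"
        unfolding openin_pullback_topology by blast
    qed
    show "continuous_map X (pullback_topology S g X) f"
      unfolding continuous_map_def top
    proof (intro conjI allI impI)
      show "f \<in> topspace X \<rightarrow> S" using fS by blast
      fix T assume "openin (pullback_topology S g X) T"
      then obtain U where U: "openin X U" "T = g -` U \<inter> S"
        unfolding openin_pullback_topology by blast
      have "f x \<in> T \<longleftrightarrow> x \<in> U" if "x \<in> topspace X" for x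
        using gf[OF that] fS[OF that] unfolding U(2) by simp
      then have "{x \<in> topspace X. f x \<in> T} = U"
        using openin_subset[OF U(1)] by blast
      then show "openin X {x \<in> topspace X. f x \<in> T}" using U(1) by simp
    qed
  next
    show "g (f x) = x" if "x \<in> topspace X" for x using gf[OF that] .
    show "f (g y) = y" if "y \<in> topspace (pullback_topology S g X)" for y
      using fg that unfolding top by blast
  qed
  then show ?thesis unfolding homeomorphic_space_def by blast
qed

text \<open>
  As \<open>vol\<close> does, \<open>sofic\<close> refers to a fixed left Haar measure.
\<close>

definition sofic :: "'g::topological_group_add measure \<Rightarrow> bool"
  where "sofic Haar \<longleftrightarrow>
    (\<exists>(M :: nat \<Rightarrow> nat set topology) D \<alpha>. sofic_approximation Haar M D \<alpha>)"

end

theory Submission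
  imports Defs
begin

text \<open>
  An open set \<open>A\<close> of \<open>G\<close> is a local \<open>G\<close>-space under right translation, with canonical measure the
  restriction of left Haar measure, and \<open>A[U]\<close> consists of the \<open>x\<close> in \<open>A\<close> with \<open>xU\<close> contained in
  \<open>A\<close>.  If \<open>F\<close> is almost invariant under left multiplication by the compact set
  \<open>(closure U)\<^sup>-\<^sup>1\<close>, then \<open>A = F\<^sup>-\<^sup>1U\<close> works: \<open>F\<^sup>-\<^sup>1\<close> lies in \<open>A[U]\<close>, and \<open>A\<^sup>-\<^sup>1 = U\<^sup>-\<^sup>1F\<close> is hardly
  larger than \<open>F\<close>.  Unimodularity enters through the inversion.  The image of Haar measure under
  inversion is again a left Haar measure, and amenability is applied to that measure, so uniqueness
  of Haar measure is not needed.
\<close>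

section \<open>Borel sets and Radon measures on open subspaces\<close>

lemma space_borel_of [simp]: "space (borel_of X) = topspace X"
  unfolding borel_of_def by (rule space_measure_of) (auto dest: openin_subset)

lemma sets_borel_of: "sets (borel_of X) = sigma_sets (topspace X) {U. openin X U}"
  unfolding borel_of_def by (rule sets_measure_of) (auto dest: openin_subset)

lemma openin_imp_borel_of: "openin X U \<Longrightarrow> U \<in> sets (borel_of X)"
  unfolding sets_borel_of by auto

lemma closedin_imp_borel_of: "closedin X C \<Longrightarrow> C \<in> sets (borel_of X)"
  using sets.compl_sets[OF openin_imp_borel_of[of X "topspace X - C"]]
  by (simp add: closedin_def double_diff)

lemma measurable_borel_of:
  assumes "continuous_map X Y f"
  shows "f \<in> borel_of X \<rightarrow>\<^sub>M borel_of Y"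
proof (rule measurable_sigma_sets[OF sets_borel_of])
  show "{U. openin Y U} \<subseteq> Pow (topspace Y)" by (auto dest: openin_subset)
  show "f \<in> space (borel_of X) \<rightarrow> topspace Y"
    using assms by (simp add: continuous_map_def)
  fix U assume "U \<in> {U. openin Y U}"
  then have "openin X {x \<in> topspace X. f x \<in> U}"
    using assms by (simp add: continuous_map_def)
  moreover have "{x \<in> topspace X. f x \<in> U} = f -` U \<inter> space (borel_of X)" by auto
  ultimately show "f -` U \<inter> space (borel_of X) \<in> sets (borel_of X)"
    by (metis openin_imp_borel_of)
qed

text \<open>Since \<open>A\<close> is open, the relatively open sets generating the left-hand side
  are open in \<open>X\<close>. Conversely, the inclusion of \<open>A\<close> into \<open>X\<close>
  is continuous and pulls \<open>B\<close> back to itself.\<close>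

lemma sets_borel_of_open_subtopology:
  assumes "openin X A"
  shows "B \<in> sets (borel_of (subtopology X A)) \<longleftrightarrow> B \<in> sets (borel_of X) \<and> B \<subseteq> A"
proof
  assume B: "B \<in> sets (borel_of (subtopology X A))"
  have "sigma_sets A {U. openin (subtopology X A) U} \<subseteq> {B \<in> sets (borel_of X). B \<subseteq> A}"
  proof (rule subsetI, erule sigma_sets.induct)
    fix a assume "a \<in> {U. openin (subtopology X A) U}"
    then show "a \<in> {B \<in> sets (borel_of X). B \<subseteq> A}"
      using assms by (auto simp: openin_open_subtopology intro: openin_imp_borel_of)
  qed (use assms openin_imp_borel_of in auto)
  moreover have "topspace (subtopology X A) = A"
    using openin_subset[OF assms] by (simp add: Int_absorb1)
  ultimately show "B \<in> sets (borel_of X) \<and> B \<subseteq> A"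
    using B unfolding sets_borel_of[of "subtopology X A"] by auto
next
  assume B: "B \<in> sets (borel_of X) \<and> B \<subseteq> A"
  have "id \<in> borel_of (subtopology X A) \<rightarrow>\<^sub>M borel_of X"
    by (intro measurable_borel_of continuous_map_from_subtopology continuous_map_id)
  then have "id -` B \<inter> topspace (subtopology X A) \<in> sets (borel_of (subtopology X A))"
    using B by (metis measurable_sets space_borel_of)
  moreover have "id -` B \<inter> topspace (subtopology X A) = B"
    using B openin_subset[OF assms] by auto
  ultimately show "B \<in> sets (borel_of (subtopology X A))" by simp
qed

text \<open>Regularity survives because the approximating families barely change: open supersets can
  be cut down to \<open>A\<close> without losing openness, and compact sets inside \<open>A\<close>
  are the same in both topologies.\<close>

lemma radon_measure_restrict_open:
  assumes \<mu>: "radon_measure X \<mu>" and A: "openin X A"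
  shows "radon_measure (subtopology X A) (restrict_space \<mu> A)"
proof -
  have sets: "sets \<mu> = sets (borel_of X)" using \<mu> by (simp add: radon_measure_def)
  have A\<mu>: "A \<in> sets \<mu>" "A \<inter> space \<mu> \<in> sets \<mu>"
    using openin_imp_borel_of[OF A] by (auto simp: sets)
  have sets': "B \<in> sets (restrict_space \<mu> A) \<longleftrightarrow> B \<in> sets \<mu> \<and> B \<subseteq> A" for B
    by (subst sets_restrict_space_iff) (use A\<mu> in auto)
  have em: "emeasure (restrict_space \<mu> A) B = emeasure \<mu> B" if "B \<subseteq> A" for B
    using A\<mu>(2) that by (rule emeasure_restrict_space)
  show ?thesis
    unfolding radon_measure_def
  proof (intro conjI allI impI ballI)
    show "sets (restrict_space \<mu> A) = sets (borel_of (subtopology X A))"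
      by (intro set_eqI) (simp only: sets' sets_borel_of_open_subtopology[OF A] sets)
    show "emeasure (restrict_space \<mu> A) K < \<infinity>" if "compactin (subtopology X A) K" for K
      using that \<mu> by (simp add: compactin_subtopology em radon_measure_def)
  next
    fix B assume "B \<in> sets (restrict_space \<mu> A)"
    then have B: "B \<in> sets \<mu>" "B \<subseteq> A" using sets' by auto
    have "emeasure \<mu> B = (INF V \<in> {V. openin X V \<and> B \<subseteq> V}. emeasure \<mu> V)"
      using \<mu> B(1) unfolding radon_measure_def by blast
    also have "\<dots> = (INF V \<in> {V. openin (subtopology X A) V \<and> B \<subseteq> V}. emeasure \<mu> V)"
    proof (rule antisym)
      show "(INF V \<in> {V. openin X V \<and> B \<subseteq> V}. emeasure \<mu> V)
          \<le> (INF V \<in> {V. openin (subtopology X A) V \<and> B \<subseteq> V}. emeasure \<mu> V)"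
        by (rule INF_superset_mono) (auto simp: openin_open_subtopology[OF A])
      show "(INF V \<in> {V. openin (subtopology X A) V \<and> B \<subseteq> V}. emeasure \<mu> V)
          \<le> (INF V \<in> {V. openin X V \<and> B \<subseteq> V}. emeasure \<mu> V)"
      proof (rule INF_mono)
        fix V assume V: "V \<in> {V. openin X V \<and> B \<subseteq> V}"
        then have "V \<inter> A \<in> {V. openin (subtopology X A) V \<and> B \<subseteq> V}"
          using B(2) A by (auto simp: openin_open_subtopology)
        moreover have "emeasure \<mu> (V \<inter> A) \<le> emeasure \<mu> V"
          using V openin_imp_borel_of sets by (intro emeasure_mono) auto
        ultimately show "\<exists>W \<in> {V. openin (subtopology X A) V \<and> B \<subseteq> V}. emeasure \<mu> W \<le> emeasure \<mu> V"
          by blast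
      qed
    qed
    also have "\<dots> = (INF V \<in> {V. openin (subtopology X A) V \<and> B \<subseteq> V}. emeasure (restrict_space \<mu> A) V)"
      by (rule INF_cong) (auto simp: openin_open_subtopology[OF A] em)
    finally show "emeasure (restrict_space \<mu> A) B =
        (INF V \<in> {V. openin (subtopology X A) V \<and> B \<subseteq> V}. emeasure (restrict_space \<mu> A) V)"
      by (simp add: em B(2))
  next
    fix V assume "openin (subtopology X A) V"
    then have V: "openin X V" "V \<subseteq> A" by (auto simp: openin_open_subtopology[OF A])
    have "emeasure \<mu> V = (SUP K \<in> {K. compactin X K \<and> K \<subseteq> V}. emeasure \<mu> K)"
      using \<mu> V(1) unfolding radon_measure_def by blast
    also have "\<dots> = (SUP K \<in> {K. compactin (subtopology X A) K \<and> K \<subseteq> V}. emeasure (restrict_space \<mu> A) K)"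
      by (rule SUP_cong) (use V(2) in \<open>auto simp: compactin_subtopology em\<close>)
    finally show "emeasure (restrict_space \<mu> A) V =
        (SUP K \<in> {K. compactin (subtopology X A) K \<and> K \<subseteq> V}. emeasure (restrict_space \<mu> A) K)"
      by (simp add: em V(2))
  qed
qed

section \<open>Transport of Radon measures along homeomorphisms\<close>

text \<open>Reindexes the infimum and supremum of the regularity conditions: \<open>P\<close> and
  \<open>Q\<close> will stand for "open and containing a given set" or "compact and inside a given
  set" on the two sides of a homeomorphism.\<close>

lemma homeomorphic_maps_collect_image:
  assumes "homeomorphic_maps X Y f g"
    and "\<And>S. P S \<Longrightarrow> S \<subseteq> topspace X \<and> Q (f ` S)" "\<And>T. Q T \<Longrightarrow> T \<subseteq> topspace Y \<and> P (g ` T)"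
  shows "{S. P S} = (\<lambda>T. g ` T) ` {T. Q T}"
proof -
  have gf: "g ` f ` S = S" if "S \<subseteq> topspace X" for S
    using that assms(1) unfolding homeomorphic_maps_def by force
  show ?thesis
  proof (intro set_eqI iffI)
    fix S assume "S \<in> {S. P S}"
    then show "S \<in> (\<lambda>T. g ` T) ` {T. Q T}" using gf assms(2) by (metis image_eqI mem_Collect_eq)
  qed (use assms(3) in auto)
qed

text \<open>Measurability and \<open>distr\<close> speak of preimages, topological arguments of
  images; this switches between the two.\<close>

lemma homeomorphic_maps_vimage:
  assumes fg: "homeomorphic_maps X Y f g" and B: "B \<subseteq> topspace Y"
  shows "f -` B \<inter> topspace X = g ` B"
proof (intro set_eqI iffI)
  fix x assume x: "x \<in> f -` B \<inter> topspace X"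
  then have "g (f x) = x" using fg unfolding homeomorphic_maps_def by blast
  then show "x \<in> g ` B" using x by (metis IntE image_eqI vimageE)
next
  fix x assume "x \<in> g ` B"
  then obtain y where y: "y \<in> B" "x = g y" by blast
  moreover have "f (g y) = y" "g y \<in> topspace X"
    using fg B y(1) unfolding homeomorphic_maps_def continuous_map_def by blast+
  ultimately show "x \<in> f -` B \<inter> topspace X" by simp
qed

lemma emeasure_distr_homeomorphic:
  assumes \<mu>: "sets \<mu> = sets (borel_of X)" and fg: "homeomorphic_maps X Y f g"
    and B: "B \<in> sets (borel_of Y)"
  shows "emeasure (distr \<mu> (borel_of Y) f) B = emeasure \<mu> (g ` B)"
    and "g ` B \<in> sets \<mu>"
proof -
  have sp: "space \<mu> = topspace X" using sets_eq_imp_space_eq[OF \<mu>] by simp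
  have f: "f \<in> \<mu> \<rightarrow>\<^sub>M borel_of Y"
    using fg measurable_borel_of measurable_cong_sets[OF \<mu> refl]
    unfolding homeomorphic_maps_def by blast
  have "B \<subseteq> topspace Y" using sets.sets_into_space[OF B] by simp
  then have eq: "f -` B \<inter> space \<mu> = g ` B"
    unfolding sp using homeomorphic_maps_vimage[OF fg] by simp
  show "emeasure (distr \<mu> (borel_of Y) f) B = emeasure \<mu> (g ` B)"
    using emeasure_distr[OF f B] unfolding eq .
  show "g ` B \<in> sets \<mu>" using measurable_sets[OF f B] unfolding eq .
qed

lemma radon_measure_distr_homeomorphic:
  assumes \<mu>: "radon_measure X \<mu>" and X: "Hausdorff_space X" and fg: "homeomorphic_maps X Y f g"
  shows "radon_measure Y (distr \<mu> (borel_of Y) f)"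
proof -
  have sets: "sets \<mu> = sets (borel_of X)" using \<mu> by (simp add: radon_measure_def)
  have Y: "Hausdorff_space Y"
    using X fg homeomorphic_Hausdorff_space homeomorphic_space_def by blast
  have f: "homeomorphic_map X Y f" and g: "homeomorphic_map Y X g"
    using fg homeomorphic_maps_map homeomorphic_maps_sym by blast+
  note em = emeasure_distr_homeomorphic[OF sets fg]
  have fgB: "f ` g ` B = B" if "B \<subseteq> topspace Y" for B
    using fg that unfolding homeomorphic_maps_def by force
  have sub: "g ` B \<subseteq> V \<longleftrightarrow> B \<subseteq> f ` V" if "B \<subseteq> topspace Y" "V \<subseteq> topspace X" for B V
    using fg that unfolding homeomorphic_maps_def by force
  have opens: "{V. openin X V \<and> g ` B \<subseteq> V} = (\<lambda>T. g ` T) ` {V. openin Y V \<and> B \<subseteq> V}"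
    if "B \<subseteq> topspace Y" for B
  proof (rule homeomorphic_maps_collect_image[OF fg])
    fix S assume S: "openin X S \<and> g ` B \<subseteq> S"
    then have "S \<subseteq> topspace X" by (simp add: openin_subset)
    with S that show "S \<subseteq> topspace X \<and> openin Y (f ` S) \<and> B \<subseteq> f ` S"
      using sub homeomorphic_map_openness[OF f] by simp
  next
    fix T assume T: "openin Y T \<and> B \<subseteq> T"
    then have "T \<subseteq> topspace Y" by (simp add: openin_subset)
    with T show "T \<subseteq> topspace Y \<and> openin X (g ` T) \<and> g ` B \<subseteq> g ` T"
      using homeomorphic_map_openness[OF g] by (simp add: image_mono)
  qed
  have compacts: "{K. compactin X K \<and> K \<subseteq> g ` V} = (\<lambda>T. g ` T) ` {K. compactin Y K \<and> K \<subseteq> V}"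
    if "V \<subseteq> topspace Y" for V
  proof (rule homeomorphic_maps_collect_image[OF fg])
    fix S assume "compactin X S \<and> S \<subseteq> g ` V"
    then show "S \<subseteq> topspace X \<and> compactin Y (f ` S) \<and> f ` S \<subseteq> V"
      using fgB[OF that] compactin_subset_topspace homeomorphic_map_compactness[OF f]
      by (metis image_mono)
  next
    fix T assume "compactin Y T \<and> T \<subseteq> V"
    then show "T \<subseteq> topspace Y \<and> compactin X (g ` T) \<and> g ` T \<subseteq> g ` V"
      using compactin_subset_topspace homeomorphic_map_compactness[OF g]
      by (metis image_mono)
  qed
  \<comment> \<open>Compact sets are closed in the Hausdorff space \<open>Y\<close>, hence Borel, so
    \<open>em\<close> evaluates the image measure on them.\<close>
  have cb: "K \<in> sets (borel_of Y)" if "compactin Y K" for K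
    using that closedin_imp_borel_of compactin_imp_closedin[OF Y] by blast
  show ?thesis
    unfolding radon_measure_def
  proof (intro conjI allI impI ballI)
    show "sets (distr \<mu> (borel_of Y) f) = sets (borel_of Y)" by simp
    show "emeasure (distr \<mu> (borel_of Y) f) K < \<infinity>" if K: "compactin Y K" for K
      using em(1)[OF cb[OF K]] \<mu> homeomorphic_map_compactness[OF g compactin_subset_topspace[OF K]] K
      unfolding radon_measure_def by simp
  next
    fix B assume "B \<in> sets (distr \<mu> (borel_of Y) f)"
    then have B: "B \<in> sets (borel_of Y)" by simp
    then have BY: "B \<subseteq> topspace Y" using sets.sets_into_space by fastforce
    have "emeasure \<mu> (g ` B) = (INF V \<in> {V. openin X V \<and> g ` B \<subseteq> V}. emeasure \<mu> V)"
      using \<mu> em(2)[OF B] unfolding radon_measure_def by blast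
    also have "\<dots> = (INF V \<in> {V. openin Y V \<and> B \<subseteq> V}. emeasure (distr \<mu> (borel_of Y) f) V)"
      unfolding opens[OF BY] image_image
      by (rule INF_cong) (auto simp: em(1) openin_imp_borel_of)
    finally show "emeasure (distr \<mu> (borel_of Y) f) B =
        (INF V \<in> {V. openin Y V \<and> B \<subseteq> V}. emeasure (distr \<mu> (borel_of Y) f) V)"
      by (simp add: em(1)[OF B])
  next
    fix V assume V: "openin Y V"
    then have "openin X (g ` V)"
      using homeomorphic_map_openness[OF g openin_subset[OF V]] by blast
    then have "emeasure \<mu> (g ` V) = (SUP K \<in> {K. compactin X K \<and> K \<subseteq> g ` V}. emeasure \<mu> K)"
      using \<mu> unfolding radon_measure_def by blast
    also have "\<dots> = (SUP K \<in> {K. compactin Y K \<and> K \<subseteq> V}. emeasure (distr \<mu> (borel_of Y) f) K)"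
      unfolding compacts[OF openin_subset[OF V]] image_image
      by (rule SUP_cong) (auto simp: em(1) cb)
    finally show "emeasure (distr \<mu> (borel_of Y) f) V =
        (SUP K \<in> {K. compactin Y K \<and> K \<subseteq> V}. emeasure (distr \<mu> (borel_of Y) f) K)"
      by (simp add: em(1)[OF openin_imp_borel_of[OF V]])
  qed
qed

section \<open>The topology of \<open>G\<close> and its left translations\<close>

lemma Hausdorff_space_euclidean_t2: "Hausdorff_space (euclidean :: 'a::t2_space topology)"
  unfolding Hausdorff_space_def disjnt_def by simp (metis hausdorff)

lemma second_countable_euclidean:
  "second_countable (euclidean :: 'a::second_countable_topology topology)"
proof -
  obtain \<B> :: "'a set set" where "countable \<B>" "topological_basis \<B>"
    using ex_countable_basis by blast
  then show ?thesis
    unfolding second_countable_def open_openin[symmetric]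
    by (meson topological_basisE topological_basis_open)
qed

lemma radon_measure_euclidean_sets:
  "radon_measure euclidean \<mu> \<Longrightarrow> sets \<mu> = sets borel"
  by (simp add: radon_measure_def borel_of_euclidean)

lemma homeomorphic_map_left_add:
  "homeomorphic_map (top_of_set U) (top_of_set ((+) (x :: 'g::topological_group_add) ` U)) ((+) x)"
proof -
  have "homeomorphic_maps (top_of_set U) (top_of_set ((+) x ` U)) ((+) x) ((+) (- x))"
    unfolding homeomorphic_maps_def
    by (auto simp: continuous_map_in_subtopology add.assoc[symmetric] intro!: continuous_intros)
  then show ?thesis using homeomorphic_maps_map by blast
qed

lemma open_left_add:
  fixes x :: "'g::topological_group_add"
  assumes "open U" shows "open ((+) x ` U)"
proof -
  have "(+) x ` U = (+) (- x) -` U" by (force simp: add.assoc[symmetric] image_iff)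
  then show ?thesis using assms by (auto intro!: open_vimage continuous_intros)
qed

text \<open>The good points \<open>A[U]\<close> for right translation on \<open>A\<close>;
  \<open>good_points_act\<close> establishes this for open \<open>U\<close> containing
  \<open>0\<close>.\<close>

definition core :: "'g::topological_group_add set \<Rightarrow> 'g set \<Rightarrow> 'g set"
  where "core A U = {x \<in> A. \<forall>u \<in> U. x + u \<in> A}"

text \<open>
  Measurable even when \<open>U\<close> is uncountable: the complement of \<open>core A U\<close> in \<open>A\<close> is relatively open.
\<close>

lemma borel_core:
  fixes A :: "'g::topological_group_add set"
  assumes "open A" "open U" shows "core A U \<in> sets borel"
proof -
  have eq: "core A U = A - (\<Union>c \<in> - A. (\<lambda>x. - x + c) -` U)"
  proof (intro set_eqI iffI)
    fix x assume x: "x \<in> core A U"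
    have "- x + c \<notin> U" if "c \<notin> A" for c
    proof
      assume "- x + c \<in> U"
      then have "x + (- x + c) \<in> A" using x unfolding core_def by blast
      then show False using that by (simp add: add.assoc[symmetric])
    qed
    then show "x \<in> A - (\<Union>c \<in> - A. (\<lambda>x. - x + c) -` U)" using x unfolding core_def by auto
  next
    fix x assume x: "x \<in> A - (\<Union>c \<in> - A. (\<lambda>x. - x + c) -` U)"
    have "x + u \<in> A" if "u \<in> U" for u
    proof (rule ccontr)
      assume "x + u \<notin> A"
      moreover have "- x + (x + u) = u" by (simp add: add.assoc[symmetric])
      ultimately have "x \<in> (\<Union>c \<in> - A. (\<lambda>x. - x + c) -` U)"
        using that by (intro UN_I[of "x + u"]) simp_all
      then show False using x by blast
    qed
    then show "x \<in> core A U" using x unfolding core_def by auto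
  qed
  have "open (\<Union>c \<in> - A. (\<lambda>x. - x + c) -` U)"
    using assms(2) by (intro open_UN ballI open_vimage continuous_intros)
  then show ?thesis unfolding eq using assms(1) by auto
qed

section \<open>An open subset of \<open>G\<close> as a local \<open>G\<close>-space\<close>

text \<open>Working in a homeomorphic copy \<open>M\<close> of \<open>A\<close> allows the points to
  be of type \<open>nat set\<close>, as \<open>sofic\<close> demands. Nonemptiness of
  \<open>A\<close> provides a centre for the chart that determines \<open>vol\<close>.\<close>

locale open_subset_copy =
  fixes Haar :: "'g::{topological_group_add, t2_space, second_countable_topology} measure"
    and A :: "'g set" and M :: "'m topology" and \<phi> :: "'g \<Rightarrow> 'm" and \<psi> :: "'m \<Rightarrow> 'g"
  assumes loc_compact: "locally_compact_space (euclidean :: 'g topology)"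
    and haar: "left_haar_measure Haar"
    and open_A: "open A" and A_ne: "A \<noteq> {}"
    and homeo: "homeomorphic_maps (top_of_set A) M \<phi> \<psi>"
begin

definition act_dom :: "('m \<times> 'g) set"
  where "act_dom = {(q, g). q \<in> topspace M \<and> \<psi> q + g \<in> A}"

definition act :: "'m \<Rightarrow> 'g \<Rightarrow> 'm"
  where "act q g = \<phi> (\<psi> q + g)"

lemma \<psi>_in: "q \<in> topspace M \<Longrightarrow> \<psi> q \<in> A"
  and \<phi>_in: "x \<in> A \<Longrightarrow> \<phi> x \<in> topspace M"
  and \<phi>_\<psi>: "q \<in> topspace M \<Longrightarrow> \<phi> (\<psi> q) = q"
  and \<psi>_\<phi>: "x \<in> A \<Longrightarrow> \<psi> (\<phi> x) = x"
  using homeo unfolding homeomorphic_maps_def continuous_map_def by auto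

lemma homeo_\<phi>: "homeomorphic_map (top_of_set A) M \<phi>"
  and homeo_\<psi>: "homeomorphic_map M (top_of_set A) \<psi>"
  using homeo homeomorphic_maps_map homeomorphic_maps_sym by blast+

lemma topspace_eq: "topspace M = \<phi> ` A"
  using \<phi>_in \<phi>_\<psi> \<psi>_in by (metis image_eqI image_subsetI subsetI subset_antisym)

lemma Hausdorff_M: "Hausdorff_space M"
  using Hausdorff_space_euclidean_t2 Hausdorff_space_subtopology homeo
    homeomorphic_Hausdorff_space homeomorphic_space_def by metis

text \<open>Gives both topological axioms of the action: \<open>act_dom\<close> is the preimage of
  \<open>A\<close> under this map, and the action is this map followed by
  \<open>\<phi>\<close>.\<close>

lemma continuous_sum:
  "continuous_map (prod_topology M euclidean) euclidean (\<lambda>z. \<psi> (fst z) + snd z)"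
proof -
  have \<psi>: "continuous_map M euclidean \<psi>"
    using homeo by (auto simp: homeomorphic_maps_def continuous_map_in_subtopology)
  have "continuous_map (prod_topology M euclidean) (prod_topology euclidean euclidean)
      (\<lambda>z. (\<psi> (fst z), snd z :: 'g))"
    by (intro continuous_map_pairedI continuous_map_compose[OF continuous_map_fst \<psi>, unfolded o_def]
        continuous_map_snd)
  moreover have "continuous_map (prod_topology euclidean euclidean) euclidean (\<lambda>z :: 'g \<times> 'g. fst z + snd z)"
    by (auto simp: euclidean_product_topology intro!: continuous_intros)
  ultimately have "continuous_map (prod_topology M euclidean) euclidean
      ((\<lambda>z. fst z + snd z) \<circ> (\<lambda>z. (\<psi> (fst z), snd z)))"
    by (rule continuous_map_compose)
  then show ?thesis by (simp add: o_def)
qed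

lemma openin_image_\<phi>: "openin M (\<phi> ` B)" if "open B" "B \<subseteq> A" for B
  using homeomorphic_map_openness[OF homeo_\<phi>, of B] that open_A by (simp add: openin_open_eq)

text \<open>The orbit map of \<open>p\<close> is left translation by \<open>\<psi> p\<close>
  followed by \<open>\<phi>\<close>, each a homeomorphism onto an open image. It serves both
  homogeneity and the description of good points.\<close>

lemma orbit_map_homeo_act:
  assumes p: "p \<in> topspace M" and U: "open U" "0 \<in> U" and sub: "\<And>g. g \<in> U \<Longrightarrow> \<psi> p + g \<in> A"
  shows "orbit_map_homeo M act_dom act p U"
proof -
  let ?B = "(+) (\<psi> p) ` U"
  let ?V = "\<phi> ` ?B"
  have BA: "?B \<subseteq> A" using sub by auto
  have V: "openin M ?V" by (rule openin_image_\<phi>[OF open_left_add[OF U(1)] BA])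
  have "homeomorphic_map (subtopology (top_of_set A) ?B) (subtopology M ?V) \<phi>"
    by (rule homeomorphic_map_subtopologies[OF homeo_\<phi>])
      (use BA openin_subset[OF V] in \<open>simp add: Int_absorb1\<close>)
  then have "homeomorphic_map (top_of_set ?B) (subtopology M ?V) \<phi>"
    using BA by (simp add: subtopology_subtopology Int_absorb1)
  from homeomorphic_map_compose[OF homeomorphic_map_left_add this]
  have "homeomorphic_map (top_of_set U) (subtopology M ?V) (act p)"
    by (simp add: o_def act_def[abs_def])
  moreover have "p \<in> ?V" using U(2) \<phi>_\<psi>[OF p] by force
  moreover have "{p} \<times> U \<subseteq> act_dom" using p sub by (auto simp: act_dom_def)
  ultimately show ?thesis using V unfolding orbit_map_homeo_def by blast
qed

lemma local_G_space_act: "local_G_space M act_dom act"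
proof -
  have sp: "top_of_set A homeomorphic_space M" using homeo homeomorphic_space_def by blast
  have "locally_compact_space (top_of_set A)"
    using loc_compact open_A Hausdorff_space_euclidean_t2
    by (intro locally_compact_space_open_subset) auto
  then have lc: "locally_compact_space M" using homeomorphic_locally_compact_space[OF sp] by blast
  have sc: "second_countable M"
    using homeomorphic_space_second_countability[OF sp]
      second_countable_subtopology[OF second_countable_euclidean] by blast
  have dom: "act_dom = {z \<in> topspace (prod_topology M euclidean). \<psi> (fst z) + snd z \<in> A}"
    by (auto simp: act_dom_def)
  have "openin (prod_topology M euclidean) act_dom"
    unfolding dom using open_A by (intro openin_continuous_map_preimage[OF continuous_sum]) simp
  moreover have "continuous_map (subtopology (prod_topology M euclidean) act_dom) M (\<lambda>(p, g). act p g)"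
  proof -
    have "continuous_map (subtopology (prod_topology M euclidean) act_dom) (top_of_set A)
        (\<lambda>z. \<psi> (fst z) + snd z)"
      using continuous_map_from_subtopology[OF continuous_sum]
      by (auto simp: continuous_map_in_subtopology act_dom_def)
    moreover have "continuous_map (top_of_set A) M \<phi>"
      using homeo by (simp add: homeomorphic_maps_def)
    ultimately have "continuous_map (subtopology (prod_topology M euclidean) act_dom) M
        (\<phi> \<circ> (\<lambda>z. \<psi> (fst z) + snd z))"
      by (rule continuous_map_compose)
    then show ?thesis by (simp add: o_def act_def case_prod_unfold)
  qed
  moreover have "\<forall>p \<in> topspace M. (p, 0) \<in> act_dom \<and> act p 0 = p"
    by (simp add: act_dom_def act_def \<phi>_\<psi> \<psi>_in)
  moreover have "\<forall>p g. (p, g) \<in> act_dom \<longrightarrow> (act p g, - g) \<in> act_dom \<and> act (act p g) (- g) = p"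
    by (simp add: act_dom_def act_def \<phi>_\<psi> \<psi>_\<phi> \<psi>_in \<phi>_in add.assoc)
  moreover have "\<forall>p g h. (p, g) \<in> act_dom \<and> (act p g, h) \<in> act_dom \<and> (p, g + h) \<in> act_dom \<longrightarrow>
      act p (g + h) = act (act p g) h"
    by (simp add: act_dom_def act_def \<psi>_\<phi> add.assoc)
  ultimately have "partial_right_action M act_dom act"
    unfolding partial_right_action_def using Hausdorff_M by blast
  moreover have "homogeneous_action M act_dom act"
    unfolding homogeneous_action_def
  proof
    fix p assume p: "p \<in> topspace M"
    \<comment> \<open>The largest set on which the orbit map of \<open>p\<close> is defined.\<close>
    let ?O = "(+) (\<psi> p) -` A"
    have "open ?O" using open_A by (intro open_vimage continuous_intros)
    moreover have "0 \<in> ?O" using \<psi>_in[OF p] by simp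
    ultimately show "\<exists>O\<^sub>p. open O\<^sub>p \<and> 0 \<in> O\<^sub>p \<and> orbit_map_homeo M act_dom act p O\<^sub>p"
      using orbit_map_homeo_act[OF p, of ?O] by (intro exI[of _ ?O]) simp
  qed
  ultimately show ?thesis
    unfolding local_G_space_def using lc sc Hausdorff_M by blast
qed

text \<open>Only definedness of the orbit map on \<open>U\<close> restricts \<open>p\<close>: once
  all translates of \<open>\<psi> p\<close> by \<open>U\<close> lie in \<open>A\<close>, the product
  condition is associativity in \<open>G\<close>, and the homeomorphism condition is
  \<open>orbit_map_homeo_act\<close>.\<close>

lemma good_points_act:
  assumes U: "open U" "0 \<in> U"
  shows "good_points M act_dom act U = \<phi> ` core A U"
proof (intro set_eqI iffI)
  fix p assume "p \<in> good_points M act_dom act U"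
  then have p: "p \<in> topspace M" and "{p} \<times> U \<subseteq> act_dom"
    unfolding good_points_def orbit_map_homeo_def by auto
  then have "\<psi> p \<in> core A U" using \<psi>_in[OF p] unfolding core_def act_dom_def by auto
  then show "p \<in> \<phi> ` core A U" using \<phi>_\<psi>[OF p] by force
next
  fix p assume "p \<in> \<phi> ` core A U"
  then obtain x where x: "x \<in> A" "\<And>u. u \<in> U \<Longrightarrow> x + u \<in> A" "p = \<phi> x"
    unfolding core_def by blast
  have p: "p \<in> topspace M" "\<psi> p = x" using x \<phi>_in \<psi>_\<phi> by auto
  have "orbit_map_homeo M act_dom act p U"
    using x p by (intro orbit_map_homeo_act U) auto
  moreover have "(p, g) \<in> act_dom \<and> (act p g, h) \<in> act_dom \<and> (p, g + h) \<in> act_dom \<and>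
      act (act p g) h = act p (g + h)" if "g \<in> U" "h \<in> U" "g + h \<in> U" for g h
  proof -
    have "x + g \<in> A" "x + (g + h) \<in> A" using x(2) that by auto
    then show ?thesis using p by (auto simp: act_dom_def act_def \<psi>_\<phi> \<phi>_in add.assoc)
  qed
  ultimately show "p \<in> good_points M act_dom act U"
    unfolding good_points_def using p(1) by blast
qed

section \<open>The canonical measure of the open subset\<close>

definition pushed_haar :: "'m measure"
  where "pushed_haar = distr (restrict_space Haar A) (borel_of M) \<phi>"

lemma
  shows radon_pushed_haar: "radon_measure M pushed_haar"
    and emeasure_pushed_haar: "K \<in> sets (borel_of M) \<Longrightarrow> emeasure pushed_haar K = emeasure Haar (\<psi> ` K)"
    and borel_image_\<psi>: "K \<in> sets (borel_of M) \<Longrightarrow> \<psi> ` K \<in> sets borel"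
proof -
  have H: "radon_measure euclidean Haar" using haar by (simp add: left_haar_measure_def)
  note sets_H = radon_measure_euclidean_sets[OF H]
  have R: "radon_measure (top_of_set A) (restrict_space Haar A)"
    using radon_measure_restrict_open[OF H] open_A by simp
  have sets_R: "sets (restrict_space Haar A) = sets (borel_of (top_of_set A))"
    using R by (simp add: radon_measure_def)
  show "radon_measure M pushed_haar"
    unfolding pushed_haar_def
    by (rule radon_measure_distr_homeomorphic[OF R _ homeo])
      (simp add: Hausdorff_space_euclidean_t2 Hausdorff_space_subtopology)
  have A_meas: "A \<inter> space Haar \<in> sets Haar"
    using open_A by (simp add: sets_H sets_eq_imp_space_eq[OF sets_H])
  {
    assume K: "K \<in> sets (borel_of M)"
    have sub: "\<psi> ` K \<subseteq> A" using sets.sets_into_space[OF K] \<psi>_in by auto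
    show "emeasure pushed_haar K = emeasure Haar (\<psi> ` K)"
      unfolding pushed_haar_def emeasure_distr_homeomorphic(1)[OF sets_R homeo K]
      by (rule emeasure_restrict_space[OF A_meas sub])
    show "\<psi> ` K \<in> sets borel"
      using emeasure_distr_homeomorphic(2)[OF sets_R homeo K] sets_restrict_space_iff[OF A_meas]
      by (simp add: sets_H)
  }
qed

text \<open>The chart equation \<open>f (act p g) = g\<close> with \<open>g = f q\<close> shows that
  \<open>act p (f q)\<close> and \<open>q\<close> have the same image under \<open>f\<close>. By
  injectivity they coincide, and solving \<open>\<psi> q = \<psi> p + f q\<close> gives the
  formula.\<close>

lemma chart_act:
  assumes "chart M act_dom act p W R f" "q \<in> W"
  shows "f q = - \<psi> p + \<psi> q"
proof -
  have W: "W \<subseteq> topspace M" and hom: "homeomorphic_map (subtopology M W) (top_of_set R) f"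
    and R: "\<And>g. g \<in> R \<Longrightarrow> (p, g) \<in> act_dom \<and> act p g \<in> W \<and> f (act p g) = g"
    using assms(1) openin_subset unfolding chart_def by blast+
  have fR: "f ` W = R" and inj: "inj_on f W"
    using homeomorphic_imp_surjective_map[OF hom] homeomorphic_imp_injective_map[OF hom] W
    by (simp_all add: Int_absorb1)
  have "f q \<in> R" using fR assms(2) by blast
  from R[OF this] have g: "\<psi> p + f q \<in> A" "act p (f q) \<in> W" "f (act p (f q)) = f q"
    by (auto simp: act_dom_def)
  have "act p (f q) = q" using inj_onD[OF inj g(3) g(2) assms(2)] .
  then have "\<psi> q = \<psi> p + f q" using \<psi>_\<phi>[OF g(1)] by (simp add: act_def)
  then show ?thesis by (simp add: add.assoc[symmetric])
qed

text \<open>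
  One chart covers the whole space, which makes the description of \<open>vol\<close> trivially unique.
\<close>

lemma chart_total:
  assumes p: "p \<in> topspace M"
  shows "chart M act_dom act p (topspace M) ((+) (- \<psi> p) ` A) (\<lambda>q. - \<psi> p + \<psi> q)"
proof -
  have "homeomorphic_map (subtopology M (topspace M)) (top_of_set ((+) (- \<psi> p) ` A)) ((+) (- \<psi> p) \<circ> \<psi>)"
    using homeomorphic_map_compose[OF homeo_\<psi> homeomorphic_map_left_add] by simp
  moreover have "0 \<in> (+) (- \<psi> p) ` A" using \<psi>_in[OF p] by force
  moreover have "(p, g) \<in> act_dom \<and> act p g \<in> topspace M \<and> - \<psi> p + \<psi> (act p g) = g"
    if g: "g \<in> (+) (- \<psi> p) ` A" for g
  proof -
    obtain x where "x \<in> A" "g = - \<psi> p + x" using g by blast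
    moreover from this have "\<psi> p + g = x" by (simp add: add.assoc[symmetric])
    ultimately show ?thesis using p \<phi>_in \<psi>_\<phi> by (simp add: act_dom_def act_def)
  qed
  ultimately show ?thesis
    unfolding chart_def using p open_left_add[OF open_A] by (simp add: o_def)
qed

text \<open>Every chart is a restriction of \<open>\<psi>\<close> followed by a left translation, so
  left invariance removes the dependence on its centre and \<open>pushed_haar\<close> qualifies. Any
  other candidate agrees with it on all Borel sets through the total chart.\<close>

lemma vol_act: "vol Haar M act_dom act = pushed_haar"
proof -
  have inv: "emeasure Haar ((\<lambda>q. - x + \<psi> q) ` K) = emeasure Haar (\<psi> ` K)"
    if "K \<in> sets (borel_of M)" for x K
    using haar borel_image_\<psi>[OF that] unfolding left_haar_measure_def left_invariant_def
    by (metis image_image)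
  show ?thesis
    unfolding vol_def
  proof (rule the_equality, intro conjI allI impI)
    show "radon_measure M pushed_haar" by (rule radon_pushed_haar)
    fix p W R f K
    assume *: "chart M act_dom act p W R f \<and> K \<in> sets (borel_of M) \<and> K \<subseteq> W"
    then have "f ` K = (\<lambda>q. - \<psi> p + \<psi> q) ` K"
      using chart_act by (intro image_cong) auto
    then show "emeasure pushed_haar K = emeasure Haar (f ` K)"
      using * inv emeasure_pushed_haar by simp
  next
    fix \<nu>
    assume \<nu>: "radon_measure M \<nu> \<and> (\<forall>p W R f K. chart M act_dom act p W R f \<and>
      K \<in> sets (borel_of M) \<and> K \<subseteq> W \<longrightarrow> emeasure \<nu> K = emeasure Haar (f ` K))"
    obtain p where p: "p \<in> topspace M" using A_ne \<phi>_in by blast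
    show "\<nu> = pushed_haar"
    proof (rule measure_eqI)
      show "sets \<nu> = sets pushed_haar" using \<nu> radon_pushed_haar by (simp add: radon_measure_def)
      fix K assume "K \<in> sets \<nu>"
      then have K: "K \<in> sets (borel_of M)" using \<nu> by (simp add: radon_measure_def)
      moreover have "K \<subseteq> topspace M" using sets.sets_into_space[OF K] by simp
      ultimately show "emeasure \<nu> K = emeasure pushed_haar K"
        using \<nu> chart_total[OF p] inv emeasure_pushed_haar by metis
    qed
  qed
qed

text \<open>Pulls the measure inequality back to \<open>A\<close>. The point to check is that the
  image of \<open>core A U\<close> is Borel, which holds because it is the preimage of a Borel set
  under \<open>\<psi>\<close>.\<close>

lemma sofic_approx_at_act:
  assumes U: "open U" "0 \<in> U" and fin: "emeasure Haar A < \<infinity>"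
    and core: "(1 - \<epsilon>) * measure Haar A \<le> measure Haar (core A U)"
  shows "sofic_approx_at Haar U \<epsilon> M act_dom act"
proof -
  have img: "\<psi> ` \<phi> ` B = B" if "B \<subseteq> A" for B
    using that \<psi>_\<phi> by (force simp: image_image)
  have coreA: "core A U \<subseteq> A" by (auto simp: core_def)
  have "\<phi> ` core A U = \<psi> -` core A U \<inter> space (borel_of M)"
    using homeomorphic_maps_vimage[OF homeomorphic_maps_sym[THEN iffD1, OF homeo], of "core A U"] coreA
    by simp
  moreover have "\<psi> \<in> borel_of M \<rightarrow>\<^sub>M borel"
    using measurable_borel_of[of M euclidean \<psi>] homeo
    by (simp add: borel_of_euclidean homeomorphic_maps_def continuous_map_in_subtopology)
  ultimately have "\<phi> ` core A U \<in> sets (borel_of M)"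
    using measurable_sets borel_core[OF open_A U(1)] by metis
  moreover have "\<phi> ` A \<in> sets (borel_of M)"
    using openin_imp_borel_of topspace_eq by (metis openin_topspace)
  ultimately have "emeasure pushed_haar (\<phi> ` core A U) = emeasure Haar (core A U)"
    "emeasure pushed_haar (\<phi> ` A) = emeasure Haar A"
    using emeasure_pushed_haar img coreA by simp_all
  then show ?thesis
    unfolding sofic_approx_at_def vol_act good_points_act[OF U] topspace_eq measure_def
    using fin core by (simp add: measure_def)
qed

end

section \<open>Exhaustion by precompact open sets\<close>

lemma compact_closure_if_subset_compact:
  fixes K :: "'a::t2_space set"
  assumes "compact K" "U \<subseteq> K" shows "compact (closure U)"
proof -
  have "closure U \<subseteq> K" using assms by (intro closure_minimal compact_imp_closed)
  then have "K \<inter> closure U = closure U" by blast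
  then show ?thesis using compact_Int_closed[OF assms(1) closed_closure, of U] by simp
qed

text \<open>Local compactness covers the space by precompact open sets, the Lindelof property makes
  the cover countable, and its finite partial unions increase to everything.\<close>

lemma precompact_open_exhaustion:
  fixes a :: "'a::{t2_space, second_countable_topology}"
  assumes "locally_compact_space (euclidean :: 'a topology)"
  obtains U :: "nat \<Rightarrow> 'a set"
  where "\<And>i. open (U i)" "\<And>i. compact (closure (U i))" "\<And>i. a \<in> U i" "incseq U" "(\<Union>i. U i) = UNIV"
proof -
  define \<F> where "\<F> = {U :: 'a set. open U \<and> compact (closure U)}"
  have ex: "\<exists>U \<in> \<F>. x \<in> U" for x
  proof -
    obtain U K where "open U" "compact K" "x \<in> U" "U \<subseteq> K"
      using assms unfolding locally_compact_space_def by simp meson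
    then show ?thesis using compact_closure_if_subset_compact unfolding \<F>_def by blast
  qed
  obtain \<F>' where \<F>': "\<F>' \<subseteq> \<F>" "countable \<F>'" "\<Union>\<F>' = \<Union>\<F>"
    by (rule Lindelof[of \<F>]) (auto simp: \<F>_def)
  obtain V where V: "V \<in> \<F>" "a \<in> V" using ex by blast
  \<comment> \<open>Inserting \<open>V\<close> ensures a nonempty family, so that
    \<open>from_nat_into\<close> enumerates exactly its members.\<close>
  define W where "W = from_nat_into (insert V \<F>')"
  have W: "range W = insert V \<F>'"
    unfolding W_def using \<F>'(2) by (intro range_from_nat_into) auto
  have W\<F>: "W k \<in> \<F>" for k
    using rangeI[of W k] V(1) \<F>'(1) unfolding W by auto
  define U where "U n = V \<union> (\<Union>k\<le>n. W k)" for n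
  show ?thesis
  proof (rule that)
    show "open (U i)" for i
      using V(1) W\<F> unfolding U_def \<F>_def by (intro open_Un open_UN) auto
    show "compact (closure (U i))" for i
    proof (rule compact_closure_if_subset_compact)
      show "compact (closure V \<union> (\<Union>k\<le>i. closure (W k)))"
        using V(1) W\<F> unfolding \<F>_def by (intro compact_Un compact_UN) auto
      show "U i \<subseteq> closure V \<union> (\<Union>k\<le>i. closure (W k))"
        unfolding U_def using closure_subset by (intro Un_mono UN_mono) auto
    qed
    show "a \<in> U i" for i using V(2) unfolding U_def by blast
    show "incseq U" unfolding U_def incseq_def by fastforce
    show "(\<Union>i. U i) = UNIV"
    proof (intro set_eqI iffI UNIV_I)
      fix x :: 'a
      obtain S where "S \<in> \<F>'" "x \<in> S" using ex \<F>'(3) by blast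
      moreover then have "S \<in> range W" by (simp add: W)
      then obtain k where "W k = S" by blast
      ultimately show "x \<in> (\<Union>i. U i)" unfolding U_def by auto
    qed
  qed
qed

section \<open>Haar measure under inversion\<close>

lemma homeomorphic_maps_uminus:
  "homeomorphic_maps euclidean euclidean uminus (uminus :: 'g::topological_group_add \<Rightarrow> 'g)"
  unfolding homeomorphic_maps_def by (simp add: continuous_on_minus)

lemma emeasure_distr_uminus:
  fixes \<mu> :: "'g::topological_group_add measure"
  assumes "sets \<mu> = sets borel" "B \<in> sets borel"
  shows "emeasure (distr \<mu> borel uminus) B = emeasure \<mu> (uminus ` B)"
    and "uminus ` B \<in> sets borel"
  using emeasure_distr_homeomorphic[OF _ homeomorphic_maps_uminus, of \<mu> B] assms
  by (simp_all add: borel_of_euclidean)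

text \<open>Inversion turns left translates into right translates,
  \<open>- (g + x) = - x + - g\<close>, so right invariance of \<open>\<mu>\<close> becomes left
  invariance of its image.\<close>

lemma left_haar_measure_distr_uminus:
  fixes \<mu> :: "'g::{topological_group_add, t2_space} measure"
  assumes \<mu>: "left_haar_measure \<mu>" and inv: "right_invariant \<mu>"
  shows "left_haar_measure (distr \<mu> borel uminus)"
proof -
  have R: "radon_measure euclidean \<mu>" and nz: "emeasure \<mu> UNIV \<noteq> 0"
    using \<mu> by (auto simp: left_haar_measure_def)
  note em = emeasure_distr_uminus[OF radon_measure_euclidean_sets[OF R]]
  have "radon_measure euclidean (distr \<mu> borel uminus)"
    using radon_measure_distr_homeomorphic[OF R Hausdorff_space_euclidean_t2 homeomorphic_maps_uminus]
    by (simp add: borel_of_euclidean)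
  moreover have "emeasure (distr \<mu> borel uminus) UNIV \<noteq> 0"
    using nz by (simp add: em(1) surj_uminus)
  moreover have "left_invariant (distr \<mu> borel uminus)"
    unfolding left_invariant_def
  proof (intro allI ballI)
    fix g :: 'g and A :: "'g set" assume A: "A \<in> sets borel"
    have "(\<lambda>x. g + x) ` A = (\<lambda>x. - g + x) -` A \<inter> space borel"
      by (force simp: image_iff add.assoc[symmetric])
    moreover have "(\<lambda>x. - g + x) \<in> borel_measurable borel"
      by (intro borel_measurable_continuous_onI continuous_intros)
    ultimately have gA: "(\<lambda>x. g + x) ` A \<in> sets borel"
      using A measurable_sets by metis
    have "uminus ` (\<lambda>x. g + x) ` A = (\<lambda>x. x + - g) ` uminus ` A"
      unfolding image_image by (simp add: minus_add)
    then show "emeasure (distr \<mu> borel uminus) ((\<lambda>x. g + x) ` A) = emeasure (distr \<mu> borel uminus) A"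
      using inv em(2)[OF A] unfolding em(1)[OF A] em(1)[OF gA] right_invariant_def by metis
  qed
  ultimately show ?thesis by (simp add: left_haar_measure_def)
qed

section \<open>From almost invariant sets to open sets with large core\<close>

text \<open>With \<open>m\<close> the \<open>\<nu>\<close>-measure of an almost invariant set
  \<open>B\<close>, the set \<open>A\<close> has measure at most \<open>(1 + \<epsilon>) * m\<close>
  and its core at least \<open>m\<close>; the claim follows from
  \<open>(1 - \<epsilon>) * (1 + \<epsilon>) \<le> 1\<close>.\<close>

lemma core_approximation:
  fixes Haar :: "'g::{topological_group_add, t2_space} measure"
  assumes haar: "left_haar_measure Haar" and "unimodular TYPE('g)" and "amenable TYPE('g)"
    and U: "open U" "compact (closure U)" "0 \<in> U" and \<epsilon>: "0 < \<epsilon>" "\<epsilon> \<le> 1"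
  obtains A where "open A" "A \<noteq> {}" "emeasure Haar A < \<infinity>"
    "(1 - \<epsilon>) * measure Haar A \<le> measure Haar (core A U)"
proof -
  define \<nu> where "\<nu> = distr Haar borel uminus"
  have sets: "sets Haar = sets borel"
    using haar by (simp add: left_haar_measure_def radon_measure_euclidean_sets)
  have em: "emeasure \<nu> B = emeasure Haar (uminus ` B)" "uminus ` B \<in> sets Haar"
    if "B \<in> sets borel" for B
    using emeasure_distr_uminus[OF sets that] by (simp_all add: \<nu>_def sets)
  have \<nu>: "left_haar_measure \<nu>"
    using assms(1,2) left_haar_measure_distr_uminus unfolding unimodular_def \<nu>_def by blast
  \<comment> \<open>Inverting \<open>- f + u\<close> gives \<open>- u + f\<close>, so the inverse of
    the set \<open>A\<close> below lies in the product of this compact set with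
    \<open>B\<close>.\<close>
  let ?K = "uminus ` closure U"
  have "compact ?K" using U(2) by (intro compact_continuous_image continuous_intros)
  moreover have "?K \<noteq> {}" using U(3) closure_subset by blast
  ultimately obtain F where F: "\<And>i. F i \<in> sets borel" "\<And>i. 0 < emeasure \<nu> (F i)"
      "\<And>i. emeasure \<nu> (F i) < \<infinity>"
    and lim: "(\<lambda>i. outer_measure_of \<nu> {k + f | k f. k \<in> ?K \<and> f \<in> F i} / emeasure \<nu> (F i))
            \<longlonglongrightarrow> 1"
    using \<nu> assms(3) unfolding amenable_def by blast
  have "(1 :: ennreal) < ennreal (1 + \<epsilon>)" using \<epsilon> by simp
  from order_tendstoD(2)[OF lim this] obtain i where
    i: "outer_measure_of \<nu> {k + f | k f. k \<in> ?K \<and> f \<in> F i} / emeasure \<nu> (F i) < ennreal (1 + \<epsilon>)"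
    by (auto simp: eventually_sequentially)
  define B where "B = F i"
  define m where "m = emeasure \<nu> B"
  have B: "B \<in> sets borel" and m: "0 < m" "m < \<infinity>" using F by (auto simp: B_def m_def)
  let ?KB = "{k + f | k f. k \<in> ?K \<and> f \<in> B}"
  \<comment> \<open>As a union of translates of \<open>U\<close> this is open, although
    \<open>B\<close> is merely Borel.\<close>
  define A where "A = (\<Union>f \<in> B. (+) (- f) ` U)"
  have "open A" unfolding A_def by (intro open_UN ballI open_left_add U(1))
  have "uminus ` A \<subseteq> ?KB"
  proof
    fix y assume "y \<in> uminus ` A"
    then obtain f u where "f \<in> B" "u \<in> U" "y = - (- f + u)" unfolding A_def by blast
    then show "y \<in> ?KB" using closure_subset[of U] by (auto simp: minus_add)
  qed
  \<comment> \<open>The product set may fail to be Borel, but the inverse of \<open>A\<close> is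
    Borel, so there the outer measure is the measure.\<close>
  then have "emeasure \<nu> (uminus ` A) \<le> outer_measure_of \<nu> ?KB"
    using outer_measure_of_mono[of "uminus ` A" ?KB \<nu>] em(2)[of A] \<open>open A\<close> sets
    by (simp add: \<nu>_def)
  moreover have "emeasure \<nu> (uminus ` A) = emeasure Haar A"
    using em(1)[of "uminus ` A"] em(2)[of A] \<open>open A\<close> sets by (simp add: image_image)
  \<comment> \<open>Cancelling \<open>m\<close> in the extended reals is legitimate since it is
    neither zero nor infinite.\<close>
  moreover have "outer_measure_of \<nu> ?KB = (outer_measure_of \<nu> ?KB / m) * m"
    using m by (simp add: ennreal_divide_times ennreal_divide_self)
  moreover have "\<dots> \<le> ennreal (1 + \<epsilon>) * m"
    using i by (intro mult_right_mono) (auto simp: B_def m_def)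
  ultimately have le: "emeasure Haar A \<le> ennreal (1 + \<epsilon>) * m" by simp
  then have fin: "emeasure Haar A < \<infinity>"
    using m(2) by (metis ennreal_mult_less_top ennreal_less_top infinity_ennreal_def order_le_less_trans)
  \<comment> \<open>All \<open>- f + u\<close> with \<open>f\<close> in \<open>B\<close> and
    \<open>u\<close> in \<open>U\<close> lie in \<open>A\<close> by construction;
    \<open>0 \<in> U\<close> puts \<open>- f\<close> itself there.\<close>
  have sub: "uminus ` B \<subseteq> core A U"
    using U(3) unfolding core_def A_def by force
  have coreA: "core A U \<subseteq> A" by (auto simp: core_def)
  have "B \<noteq> {}" using m(1) by (auto simp: m_def)
  then have "A \<noteq> {}" using sub coreA by blast
  have core_sets: "core A U \<in> sets Haar" using borel_core \<open>open A\<close> U(1) sets by simp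
  have A_sets: "A \<in> sets Haar" using \<open>open A\<close> sets by simp
  have core_fin: "emeasure Haar (core A U) < \<infinity>"
    using emeasure_mono[OF coreA A_sets] fin by simp
  have "m \<le> emeasure Haar (core A U)"
    unfolding m_def em(1)[OF B] by (rule emeasure_mono[OF sub core_sets])
  \<comment> \<open>\<open>enn2real\<close> sends infinity to \<open>0\<close>, so its monotonicity
    relies on the core having finite measure.\<close>
  then have "enn2real m \<le> measure Haar (core A U)"
    unfolding measure_def using core_fin by (intro enn2real_mono) auto
  moreover have "measure Haar A \<le> (1 + \<epsilon>) * enn2real m"
    using enn2real_mono[OF le] m(2) \<epsilon>
    by (simp add: measure_def enn2real_mult ennreal_mult_less_top del: ennreal_plus)
  \<comment> \<open>The bound \<open>\<epsilon> \<le> 1\<close> keeps the multiplier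
    nonnegative.\<close>
  then have "(1 - \<epsilon>) * measure Haar A \<le> (1 - \<epsilon>) * ((1 + \<epsilon>) * enn2real m)"
    using \<epsilon> by (intro mult_left_mono) auto
  moreover have "(1 - \<epsilon>) * ((1 + \<epsilon>) * enn2real m) \<le> enn2real m"
  proof -
    have "(1 - \<epsilon>) * ((1 + \<epsilon>) * enn2real m) = enn2real m - \<epsilon>\<^sup>2 * enn2real m"
      by (simp add: algebra_simps power2_eq_square)
    then show ?thesis by simp
  qed
  ultimately show ?thesis
    using that[OF \<open>open A\<close> \<open>A \<noteq> {}\<close> fin] by linarith
qed

theorem theorem3p3:
  fixes Haar :: "'g::{topological_group_add, t2_space, second_countable_topology} measure"
  assumes "locally_compact_space (euclidean :: 'g topology)"
    and "left_haar_measure Haar"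
    and "unimodular TYPE('g)"
    and "amenable TYPE('g)"
  shows "sofic Haar"
proof -
  obtain U :: "nat \<Rightarrow> 'g set" where U: "\<And>i. open (U i)" "\<And>i. compact (closure (U i))" "\<And>i. 0 \<in> U i"
      "incseq U" "(\<Union>i. U i) = UNIV"
    using precompact_open_exhaustion[OF assms(1)] by blast
  \<comment> \<open>The successor keeps every term positive and at most \<open>1\<close>, as
    \<open>core_approximation\<close> requires.\<close>
  define \<epsilon> where "\<epsilon> i = inverse (real (Suc i))" for i
  have \<epsilon>: "0 < \<epsilon> i" "\<epsilon> i \<le> 1" for i by (simp_all add: \<epsilon>_def field_simps)
  have "\<exists>(M :: nat set topology) D \<alpha>. local_G_space M D \<alpha> \<and>
      sofic_approx_at Haar (U i) (\<epsilon> i) M D \<alpha> \<and> topspace M \<noteq> {}" for i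
  proof -
    obtain A where A: "open A" "A \<noteq> {}" "emeasure Haar A < \<infinity>"
        "(1 - \<epsilon> i) * measure Haar A \<le> measure Haar (core A (U i))"
      by (rule core_approximation[OF assms(2-4) U(1-3) \<epsilon>])
    \<comment> \<open>Points of type \<open>'g\<close> are exchanged for points of type
      \<open>nat set\<close>.\<close>
    obtain M :: "nat set topology" and \<phi> \<psi> where "homeomorphic_maps (top_of_set A) M \<phi> \<psi>"
      using second_countable_Hausdorff_nat_set_copy[of "top_of_set A"]
        second_countable_subtopology[OF second_countable_euclidean]
        Hausdorff_space_subtopology[OF Hausdorff_space_euclidean_t2]
      unfolding homeomorphic_space_def by blast
    then interpret open_subset_copy Haar A M \<phi> \<psi>
      using assms(1,2) A(1,2) by unfold_locales
    show ?thesis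
      using local_G_space_act sofic_approx_at_act[OF U(1,3) A(3,4)] A(2) topspace_eq by blast
  qed
  then obtain M :: "nat \<Rightarrow> nat set topology" and D \<alpha> where
    "\<And>i. local_G_space (M i) (D i) (\<alpha> i)" "\<And>i. topspace (M i) \<noteq> {}"
    "\<And>i. sofic_approx_at Haar (U i) (\<epsilon> i) (M i) (D i) (\<alpha> i)"
    by metis
  moreover have "decseq \<epsilon>" by (intro decseq_SucI) (simp add: \<epsilon>_def field_simps)
  moreover have "\<epsilon> \<longlonglongrightarrow> 0"
    unfolding \<epsilon>_def by (rule LIMSEQ_inverse_real_of_nat)
  ultimately have "sofic_approximation Haar M D \<alpha>"
    unfolding sofic_approximation_def using U \<epsilon>(1) by (intro conjI exI[of _ U] exI[of _ \<epsilon>]) auto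
  then show ?thesis unfolding sofic_def by blast
qed

end
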